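(* Let $K$ satisfy $0\le K(i,j)=K(j,i)\le\kappa ij$ for some $\kappa>0$, and $\delta_i:=\inf_{j\ge i}K(i,j)>0$ for all $i\ge1$. Let $x_0\in\mathcal X_{1,1}^+$ with $x_{1,0}>0$ and $\|x_0\|_{1,1}=1$, and let $(\ell,x)$, $(t_i)_{i\ge 0}$ and $t_\infty=\lim_i t_i$ be the corresponding solution of the deterministic min-driven coagulation equation. (i) If there is $A_0>0$ such that $K(i,j)\le(\ln(i+1)\wedge\ln(j+1))/(4A_0)$ for all $i,j\ge1$, then $t_\infty=\infty$. (ii) If there are $a_0>0$ and $\alpha>0$ such that $K(i,j)\ge a_0(\ln(i+1)\wedge\ln(j+1))^{1+\alpha}$ for all $i,j\ge1$, then $t_\infty<\infty$.
   Context: Notation: $\|x\|_{1,1}=\sum_i i|x_i|$, $\mathcal X_{1,1}=\{x:\|x\|_{1,1}<\infty\}$, and $\mathcal X_{1,m}=\{x\in\mathcal X_{1,1}:x_i=0\ \text{for } i<m\}$; $+$ denotes nonnegative entries. For $i\ge1$ define $b^{(i)}(x)$ by - $b^{(i)}_j(x)=0$ for $j<i$; - $b^{(i)}_i(x)=-2K(i,i)x_i-\sum_{j>i}K(i,j)x_j$; - $b^{(i)}_j(x)=K(j-i,i)x_{j-i}-K(i,j)x_j$ for $j>i$. The solution of the deterministic min-driven coagulation equation is the unique pair $(\ell,x)$ with the following properties. There is an increasing sequence $0=t_0<t_1<\dots$ with $\ell(t)=i$ on $[t_{i-1},t_i)$, and $t_\infty=\lim_i t_i\in(0,\infty]$.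 Moreover $x\in C([0,t_\infty);\mathcal X_{1,1})$, $x(0)=x_0$, $x(t)\in\mathcal X^+_{1,\ell(t)}\setminus\mathcal X_{1,\ell(t)+1}$ for $t<t_\infty$, and $dx/dt=b^{(\ell(t))}(x(t))$ for $t\notin\{t_i\}$. Thus $\ell(t)$ is the minimal size present at time $t$. *)

theory Defs
  imports "HOL-Analysis.Analysis"
begin

text \<open>Sequences are functions nat => real; only indices i >= 1 are meaningful
  (the value at index 0 is ignored everywhere).\<close>

definition in_X11 :: "(nat \<Rightarrow> real) \<Rightarrow> bool" where
  "in_X11 y \<longleftrightarrow> summable (\<lambda>i. real i * \<bar>y i\<bar>)"

definition norm11 :: "(nat \<Rightarrow> real) \<Rightarrow> real" where
  "norm11 y = (\<Sum>i. real i * \<bar>y i\<bar>)"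

definition bvec :: "(nat \<Rightarrow> nat \<Rightarrow> real) \<Rightarrow> nat \<Rightarrow> (nat \<Rightarrow> real) \<Rightarrow> nat \<Rightarrow> real" where
  "bvec K i y j =
     (if j < i then 0
      else if j = i then - 2 * K i i * y i - (\<Sum>k. K i (i + 1 + k) * y (i + 1 + k))
      else K (j - i) i * y (j - i) - K i j * y j)"

text \<open>t_infinity = lim t_i, as an extended real (the t_i are increasing).\<close>
definition tinf :: "(nat \<Rightarrow> real) \<Rightarrow> ereal" where
  "tinf t = (SUP i. ereal (t i))"

definition is_mdc_solution ::
  "(nat \<Rightarrow> nat \<Rightarrow> real) \<Rightarrow> (nat \<Rightarrow> real) \<Rightarrow> (real \<Rightarrow> nat) \<Rightarrow> (real \<Rightarrow> nat \<Rightarrow> real)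
     \<Rightarrow> (nat \<Rightarrow> real) \<Rightarrow> bool" where
  "is_mdc_solution K x0 l x t \<longleftrightarrow>
     t 0 = 0 \<and> strict_mono t \<and>
     (\<forall>i\<ge>1. \<forall>s. t (i - 1) \<le> s \<and> s < t i \<longrightarrow> l s = i) \<and>
     x 0 = x0 \<and>
     (\<forall>s. 0 \<le> s \<and> ereal s < tinf t \<longrightarrow>
        in_X11 (x s) \<and>
        (\<forall>i\<ge>1. 0 \<le> x s i) \<and>
        (\<forall>i. 1 \<le> i \<and> i < l s \<longrightarrow> x s i = 0) \<and>
        x s (l s) \<noteq> 0) \<and>
     (\<forall>s. 0 \<le> s \<and> ereal s < tinf t \<longrightarrow>
        (\<forall>e>0. \<exists>d>0. \<forall>s'. 0 \<le> s' \<and> ereal s' < tinf t \<and> \<bar>s' - s\<bar> < d \<longrightarrow>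
            norm11 (\<lambda>i. x s' i - x s i) < e)) \<and>
     (\<forall>s. 0 \<le> s \<and> ereal s < tinf t \<and> s \<notin> range t \<longrightarrow>
        (\<forall>j\<ge>1. ((\<lambda>r. x r j) has_real_derivative bvec K (l s) (x s) j) (at s)))"

end

theory Submission
  imports Defs
begin

text \<open>The equation is tested against finitely supported weights. The weights \<open>j\<close> for
  \<open>j \<le> R\<close> show that mass does not increase, so that a minimal size \<open>\<ell>\<close> forces the number
  \<open>N\<close> of clusters to be at most \<open>1 / \<ell>\<close>.

  (i) Here \<open>N' \<ge> - C ln (\<ell> + 1) N\<close>, hence
  \<open>ln \<ell> \<le> const + C \<integral> ln (\<ell> + 1)\<close>, and Gronwall's inequality excludes that
  \<open>\<ell>\<close> blows up in finite time.

  (ii) While the minimal size runs through \<open>[n, 2n)\<close>, every merger produces a cluster of size at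
  least \<open>2n\<close>. If \<open>K \<ge> c\<close> for sizes at least \<open>n\<close>, then \<open>N' \<le> - c N\<close>, while the
  number \<open>Q\<close> of clusters of size at least \<open>2n\<close> satisfies \<open>Q' \<ge> c (N - Q)\<close>. So \<open>Q / N \<le> 1\<close>
  grows at rate at least \<open>c\<close>, and the block lasts at most \<open>1 / c\<close>. For \<open>n = 2 ^ r\<close> these
  bounds are of order \<open>r powr (- 1 - \<alpha>)\<close> and summable.\<close>

section \<open>Monotonicity of functions differentiable off the phase changes\<close>

text \<open>The equation is only required to hold off the times \<open>t i\<close>. On each open
  piece the sign of the derivative gives monotonicity, and continuity carries it to the closed
  piece; induction on the number of pieces glues the inequalities at the breakpoints. Every
  differential inequality below is integrated in this way.\<close>

lemma piecewise_antimono: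
  fixes f :: "real \<Rightarrow> real" and t :: "nat \<Rightarrow> real"
  assumes t: "strict_mono t"
    and cont: "continuous_on {t a..t b} f"
    and deriv: "\<And>p s. a \<le> p \<Longrightarrow> p < b \<Longrightarrow> t p < s \<Longrightarrow> s < t (Suc p) \<Longrightarrow>
                  \<exists>D. (f has_real_derivative D) (at s) \<and> D \<le> 0"
    and uv: "t a \<le> u" "u \<le> v" "v \<le> t b"
  shows "f v \<le> f u"
  using cont deriv uv
proof (induction b arbitrary: u v)
  case 0
  then have "t a \<le> t 0" by linarith
  then have "a = 0" using t by (simp add: strict_mono_less_eq)
  then have "u = v" using 0 by simp
  then show ?case by simp
next
  case (Suc b)
  show ?case
  proof (cases "a \<le> b")
    case False
    then have "t (Suc b) \<le> t a" using t by (simp add: strict_mono_less_eq)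
    then have "u = v" using Suc.prems by linarith
    then show ?thesis by simp
  next
    case True
    then have tab: "t a \<le> t b" "t b \<le> t (Suc b)" using t by (simp_all add: strict_mono_less_eq)
    have left: "f v' \<le> f u'" if "t a \<le> u'" "u' \<le> v'" "v' \<le> t b" for u' v'
    proof (rule Suc.IH)
      show "continuous_on {t a..t b} f"
        using Suc.prems(1) by (rule continuous_on_subset) (use tab in auto)
    qed (use that Suc.prems(2) in auto)
    have right: "f v' \<le> f u'" if "t b \<le> u'" "u' \<le> v'" "v' \<le> t (Suc b)" for u' v'
    proof (rule DERIV_nonpos_imp_decreasing_open[where f = f])
      show "continuous_on {u'..v'} f"
        using Suc.prems(1) by (rule continuous_on_subset) (use tab that in auto)
      show "\<exists>y. (f has_real_derivative y) (at s) \<and> y \<le> 0" if "u' < s" "s < v'" for s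
        using Suc.prems(2)[of b s] True that \<open>t b \<le> u'\<close> \<open>v' \<le> t (Suc b)\<close> by auto
    qed (use that in auto)
    consider "v \<le> t b" | "t b \<le> u" | "u \<le> t b" "t b \<le> v" by linarith
    then show ?thesis
    proof cases
      case 3
      have "f v \<le> f (t b)" using 3 Suc.prems by (intro right) auto
      also have "\<dots> \<le> f u" using 3 Suc.prems by (intro left) auto
      finally show ?thesis .
    qed (use Suc.prems left right in auto)
  qed
qed

section \<open>Lipschitz cutoff weights\<close>

text \<open>Equals 1 up to \<open>L\<close>, falls linearly to 0 at \<open>2 * L\<close>. Finite
  support keeps the tested sums finite, and the slope \<open>1 / L\<close> makes truncation errors
  controllable by the mass. Since division by zero gives 0, \<open>cutoff 0\<close> is constantly
  1.\<close>

definition cutoff :: "nat \<Rightarrow> nat \<Rightarrow> real" where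
  "cutoff L j = max 0 (min 1 (2 - real j / real L))"

lemma cutoff_bounds: "0 \<le> cutoff L j" "cutoff L j \<le> 1"
  by (auto simp: cutoff_def)

lemma cutoff_eq_1: "j \<le> L \<Longrightarrow> cutoff L j = 1"
  by (cases "L = 0") (auto simp: cutoff_def divide_simps)

lemma cutoff_eq_0: "0 < L \<Longrightarrow> 2 * L < j \<Longrightarrow> cutoff L j = 0"
  by (auto simp: cutoff_def max_def min_def divide_simps)

lemma cutoff_antimono: "i \<le> j \<Longrightarrow> cutoff L j \<le> cutoff L i"
proof -
  assume "i \<le> j"
  then have "real i / real L \<le> real j / real L" by (intro divide_right_mono) auto
  then show ?thesis by (auto simp: cutoff_def max_def min_def)
qed

text \<open>Clamping to the unit interval is 1-Lipschitz, so a shift by \<open>i\<close> costs at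
  most \<open>i / L\<close>. This bounds the weight that a large cluster loses to truncation when it
  absorbs one of size \<open>i\<close>.\<close>

lemma cutoff_add_ge: "cutoff L j - real i / real L \<le> cutoff L (j + i)"
proof -
  have "real (j + i) / real L = real j / real L + real i / real L"
    by (simp add: add_divide_distrib)
  moreover have "0 \<le> real i / real L" by simp
  ultimately show ?thesis unfolding cutoff_def by linarith
qed

lemma one_minus_cutoff_le: "1 - cutoff L j \<le> real j / real L"
  using cutoff_add_ge[of L 0 j] by (simp add: cutoff_eq_1)

section \<open>Weak form of the equation\<close>

text \<open>Terms below \<open>i\<close> vanish through \<open>y\<close>, terms above
  \<open>M\<close> through \<open>\<phi>\<close>. Indexing from the minimal size allows termwise
  comparison with the series in the weak form.\<close>

lemma weighted_tail_sums:
  fixes \<phi> y :: "nat \<Rightarrow> real"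
  assumes i: "1 \<le> i" and zero: "\<And>j. 1 \<le> j \<Longrightarrow> j < i \<Longrightarrow> y j = 0"
    and supp: "\<And>j. M < j \<Longrightarrow> \<phi> j = 0"
  shows "(\<lambda>k. \<phi> (i + k) * y (i + k)) sums (\<Sum>j=1..M. \<phi> j * y j)"
proof -
  have "(\<lambda>k. \<phi> (i + k) * y (i + k)) sums (\<Sum>k\<le>M. \<phi> (i + k) * y (i + k))"
    by (rule sums_finite) (auto simp: supp)
  also have "(\<Sum>k\<le>M. \<phi> (i + k) * y (i + k)) = (\<Sum>j=i..i+M. \<phi> j * y j)"
    by (rule sum.reindex_bij_witness[of _ "\<lambda>j. j - i" "\<lambda>k. i + k"]) auto
  also have "\<dots> = (\<Sum>j=1..i+M. \<phi> j * y j)"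
    by (rule sum.mono_neutral_left) (use i zero in auto)
  also have "\<dots> = (\<Sum>j=1..M. \<phi> j * y j)"
    by (rule sum.mono_neutral_right) (use supp in auto)
  finally show ?thesis .
qed

text \<open>The weak form of the equation: a merger of sizes \<open>i\<close> and \<open>k\<close> changes the
  \<open>\<phi>\<close>-weighted count by \<open>\<phi> (k + i) - \<phi> k - \<phi> i\<close>.\<close>

lemma bvec_weighted_sums:
  fixes \<phi> y :: "nat \<Rightarrow> real"
  assumes i: "1 \<le> i" and zero: "\<And>j. 1 \<le> j \<Longrightarrow> j < i \<Longrightarrow> y j = 0"
    and supp: "\<And>j. M < j \<Longrightarrow> \<phi> j = 0"
    and sym: "\<And>k. 1 \<le> k \<Longrightarrow> K k i = K i k"
    and summ: "summable (\<lambda>k. K i (i + k) * y (i + k))"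
  shows "(\<lambda>k. K i (i + k) * y (i + k) * (\<phi> (2 * i + k) - \<phi> (i + k) - \<phi> i))
           sums (\<Sum>j=1..M. \<phi> j * bvec K i y j)"
proof -
  \<comment> \<open>\<open>f k\<close> is the rate of mergers of \<open>i\<close> with
    \<open>i + k\<close>, \<open>F\<close> the total rate, and \<open>g k\<close> the rate at which
    size \<open>i + k\<close> is produced, which requires a partner of size \<open>k\<close> at
    least \<open>i\<close>.\<close>
  define f where "f k = K i (i + k) * y (i + k)" for k
  define F where "F = (\<Sum>k. f k)"
  define g where "g k = (if k < i then 0 else f (k - i))" for k
  have fsum: "f sums F" using summ unfolding F_def f_def by (rule summable_sums)
  \<comment> \<open>A merger of two clusters of size \<open>i\<close> consumes both: one loss is
    \<open>f 0\<close>, the other is part of \<open>F\<close>.\<close>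
  have b0: "bvec K i y i = - f 0 - F"
  proof -
    have "(\<Sum>k. K i (i + 1 + k) * y (i + 1 + k)) = F - f 0"
      using suminf_split_head[of f] fsum by (simp add: sums_iff f_def)
    then show ?thesis by (simp add: bvec_def f_def)
  qed
  have b: "bvec K i y (i + k) = (if k = 0 then - F else 0) + g k - f k" for k
  proof (cases "k = 0")
    case True
    then show ?thesis using b0 i by (simp add: g_def)
  next
    case False
    have "K k i * y k = g k"
    proof (cases "k < i")
      case True
      then show ?thesis using zero[of k] False by (simp add: g_def)
    next
      case nk: False
      then show ?thesis using sym[of k] False by (simp add: g_def f_def)
    qed
    then show ?thesis using False by (simp add: bvec_def f_def)
  qed
  have 1: "(\<lambda>k. \<phi> i * f k) sums (\<phi> i * F)" using fsum by (rule sums_mult)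
  have 2: "(\<lambda>k. \<phi> (i + k) * f k) sums (\<Sum>k\<le>M. \<phi> (i + k) * f k)"
    by (rule sums_finite) (auto simp: supp)
  have 3: "(\<lambda>k. \<phi> (2 * i + k) * f k) sums (\<Sum>k\<le>M. \<phi> (2 * i + k) * f k)"
    by (rule sums_finite) (auto simp: supp)
  have g: "(\<Sum>k\<le>M. \<phi> (2 * i + k) * f k) = (\<Sum>k\<le>M. \<phi> (i + k) * g k)"
  proof -
    have "(\<Sum>k\<le>M. \<phi> (2 * i + k) * f k) = (\<Sum>k=i..i+M. \<phi> (i + k) * g k)"
      by (rule sum.reindex_bij_witness[of _ "\<lambda>j. j - i" "\<lambda>k. i + k"])
         (auto simp: g_def mult_2 add.assoc)
    also have "\<dots> = (\<Sum>k\<le>i+M. \<phi> (i + k) * g k)"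
      by (rule sum.mono_neutral_left) (auto simp: g_def)
    also have "\<dots> = (\<Sum>k\<le>M. \<phi> (i + k) * g k)"
      by (rule sum.mono_neutral_right) (auto simp: supp)
    finally show ?thesis .
  qed
  have bsum: "(\<Sum>j=1..M. \<phi> j * bvec K i y j) = (\<Sum>k\<le>M. \<phi> (i + k) * bvec K i y (i + k))"
  proof -
    have "(\<Sum>k\<le>M. \<phi> (i + k) * bvec K i y (i + k)) = (\<Sum>j=i..i+M. \<phi> j * bvec K i y j)"
      by (rule sum.reindex_bij_witness[of _ "\<lambda>j. j - i" "\<lambda>k. i + k"]) auto
    also have "\<dots> = (\<Sum>j=1..i+M. \<phi> j * bvec K i y j)"
      by (rule sum.mono_neutral_left) (use i in \<open>auto simp: bvec_def\<close>)
    also have "\<dots> = (\<Sum>j=1..M. \<phi> j * bvec K i y j)"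
      by (rule sum.mono_neutral_right) (use supp in auto)
    finally show ?thesis by simp
  qed
  have "(\<Sum>k\<le>M. \<phi> (i + k) * bvec K i y (i + k))
      = (\<Sum>k\<le>M. (if k = 0 then - \<phi> i * F else 0) + \<phi> (i + k) * g k - \<phi> (i + k) * f k)"
    by (rule sum.cong) (auto simp: b right_diff_distrib distrib_left simp del: add_0_right)
  also have "\<dots> = - \<phi> i * F + (\<Sum>k\<le>M. \<phi> (i + k) * g k) - (\<Sum>k\<le>M. \<phi> (i + k) * f k)"
    by (simp add: sum.distrib sum_subtractf)
  finally have eq: "(\<Sum>j=1..M. \<phi> j * bvec K i y j)
      = (\<Sum>k\<le>M. \<phi> (2 * i + k) * f k) - (\<Sum>k\<le>M. \<phi> (i + k) * f k) - \<phi> i * F"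
    unfolding bsum g by simp
  have "(\<lambda>k. \<phi> (2 * i + k) * f k - \<phi> (i + k) * f k - \<phi> i * f k) sums
      ((\<Sum>k\<le>M. \<phi> (2 * i + k) * f k) - (\<Sum>k\<le>M. \<phi> (i + k) * f k) - \<phi> i * F)"
    by (intro sums_diff 1 2 3)
  then show ?thesis unfolding eq f_def by (simp add: algebra_simps)
qed

section \<open>Basic properties of a solution\<close>

locale min_driven_coagulation =
  fixes K :: "nat \<Rightarrow> nat \<Rightarrow> real" and \<kappa> :: real
    and x0 :: "nat \<Rightarrow> real" and l :: "real \<Rightarrow> nat" and x :: "real \<Rightarrow> nat \<Rightarrow> real"
    and t :: "nat \<Rightarrow> real"
  assumes kappa_pos: "\<kappa> > 0"
    and K_nonneg: "\<And>i j. 1 \<le> i \<Longrightarrow> 1 \<le> j \<Longrightarrow> 0 \<le> K i j"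
    and K_sym: "\<And>i j. 1 \<le> i \<Longrightarrow> 1 \<le> j \<Longrightarrow> K i j = K j i"
    and K_bound: "\<And>i j. 1 \<le> i \<Longrightarrow> 1 \<le> j \<Longrightarrow> K i j \<le> \<kappa> * real i * real j"
    and x0_X11: "in_X11 x0"
    and x0_nonneg: "\<And>i. 1 \<le> i \<Longrightarrow> 0 \<le> x0 i"
    and x0_1: "x0 1 > 0"
    and x0_norm: "norm11 x0 = 1"
    and sol: "is_mdc_solution K x0 l x t"
begin

lemma t_0: "t 0 = 0" and t_strict: "strict_mono t" and x_0: "x 0 = x0"
  using sol by (auto simp: is_mdc_solution_def)

lemma t_nonneg: "0 \<le> t m"
  using strict_mono_less_eq[OF t_strict, of 0 m] t_0 by simp

lemma less_tinf: "s \<le> t m \<Longrightarrow> ereal s < tinf t"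
proof -
  assume "s \<le> t m"
  also have "t m < t (Suc m)" using t_strict by (simp add: strict_mono_less)
  finally have "ereal s < ereal (t (Suc m))" by simp
  also have "\<dots> \<le> tinf t" unfolding tinf_def by (rule SUP_upper) simp
  finally show ?thesis .
qed

lemma l_phase: "t p \<le> s \<Longrightarrow> s < t (Suc p) \<Longrightarrow> l s = Suc p"
proof -
  assume s: "t p \<le> s" "s < t (Suc p)"
  have "\<forall>i\<ge>1. \<forall>s. t (i - 1) \<le> s \<and> s < t i \<longrightarrow> l s = i"
    using sol unfolding is_mdc_solution_def by simp
  from this[rule_format, of "Suc p" s] show ?thesis using s by simp
qed

lemma x_props:
  assumes "0 \<le> s" "s \<le> t m"
  shows x_summable: "summable (\<lambda>j. real j * \<bar>x s j\<bar>)"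
    and x_nonneg: "1 \<le> j \<Longrightarrow> 0 \<le> x s j"
    and x_min: "1 \<le> j \<Longrightarrow> j < l s \<Longrightarrow> x s j = 0"
    and x_l: "x s (l s) \<noteq> 0"
proof -
  have "\<forall>s. 0 \<le> s \<and> ereal s < tinf t \<longrightarrow> in_X11 (x s) \<and> (\<forall>i\<ge>1. 0 \<le> x s i) \<and>
      (\<forall>i. 1 \<le> i \<and> i < l s \<longrightarrow> x s i = 0) \<and> x s (l s) \<noteq> 0"
    using sol unfolding is_mdc_solution_def by (elim conjE) assumption
  from this[rule_format, of s] less_tinf[OF assms(2)] assms(1)
  show "summable (\<lambda>j. real j * \<bar>x s j\<bar>)" "1 \<le> j \<Longrightarrow> 0 \<le> x s j"
    "1 \<le> j \<Longrightarrow> j < l s \<Longrightarrow> x s j = 0" "x s (l s) \<noteq> 0"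
    by (auto simp: in_X11_def)
qed

text \<open>The norm weights coordinate \<open>j\<close> by \<open>j\<close>, which is at least 1,
  so norm continuity dominates the change of each coordinate.\<close>

lemma x_continuous:
  assumes j: "1 \<le> j"
  shows "continuous_on {0..t m} (\<lambda>s. x s j)"
  unfolding continuous_on_iff
proof (intro ballI allI impI)
  fix s e :: real assume s: "s \<in> {0..t m}" and e: "0 < e"
  then have "0 \<le> s \<and> ereal s < tinf t" using less_tinf by auto
  moreover have sol_cont: "\<forall>s. 0 \<le> s \<and> ereal s < tinf t \<longrightarrow>
        (\<forall>e>0. \<exists>d>0. \<forall>s'. 0 \<le> s' \<and> ereal s' < tinf t \<and> \<bar>s' - s\<bar> < d \<longrightarrow>
            norm11 (\<lambda>i. x s' i - x s i) < e)"
    using sol unfolding is_mdc_solution_def by (elim conjE) assumption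
  ultimately obtain d where d: "d > 0"
    "\<And>s'. 0 \<le> s' \<Longrightarrow> ereal s' < tinf t \<Longrightarrow> \<bar>s' - s\<bar> < d \<Longrightarrow> norm11 (\<lambda>i. x s' i - x s i) < e"
    using e sol_cont by meson
  show "\<exists>d>0. \<forall>s'\<in>{0..t m}. dist s' s < d \<longrightarrow> dist (x s' j) (x s j) < e"
  proof (intro exI conjI ballI impI)
    fix s' assume s': "s' \<in> {0..t m}" "dist s' s < d"
    \<comment> \<open>A single term can be compared with the \<open>suminf\<close> in
      \<open>norm11\<close> only once the series is known to converge.\<close>
    have summ: "summable (\<lambda>i. real i * \<bar>x s' i - x s i\<bar>)"
    proof (rule summable_comparison_test')
      show "summable (\<lambda>i. real i * \<bar>x s' i\<bar> + real i * \<bar>x s i\<bar>)"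
        using s s' by (intro summable_add x_summable[of _ m]) auto
      show "norm (real i * \<bar>x s' i - x s i\<bar>) \<le> real i * \<bar>x s' i\<bar> + real i * \<bar>x s i\<bar>" for i
        using mult_left_mono[OF abs_triangle_ineq4[of "x s' i" "x s i"], of "real i"]
        by (simp add: distrib_left)
    qed
    have "\<bar>x s' j - x s j\<bar> \<le> real j * \<bar>x s' j - x s j\<bar>"
      using j by (simp add: mult_le_cancel_right1)
    also have "\<dots> \<le> norm11 (\<lambda>i. x s' i - x s i)"
      using sum_le_suminf[OF summ, of "{j}"] by (simp add: norm11_def)
    also have "\<dots> < e" using d(2)[of s'] s' less_tinf by (auto simp: dist_real_def)
    finally show "dist (x s' j) (x s j) < e" by (simp add: dist_real_def)
  qed (fact d)
qed

text \<open>A finite sum, so continuity and derivatives come from the coordinates. In the uses below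
  \<open>M\<close> bounds the support of \<open>\<phi>\<close>.\<close>

definition wsum :: "(nat \<Rightarrow> real) \<Rightarrow> nat \<Rightarrow> real \<Rightarrow> real" where
  "wsum \<phi> M s = (\<Sum>j=1..M. \<phi> j * x s j)"

lemma wsum_continuous: "0 \<le> a \<Longrightarrow> continuous_on {a..t m} (wsum \<phi> M)"
  unfolding wsum_def
  by (rule continuous_on_subset[of "{0..t m}"]) (auto intro!: continuous_intros x_continuous)

lemma in_phase:
  assumes "t p < s" "s < t (Suc p)"
  shows "0 \<le> s" "s \<le> t (Suc p)" "l s = Suc p" "s \<notin> range t"
proof -
  show "0 \<le> s" "s \<le> t (Suc p)" using assms t_nonneg[of p] by auto
  show "l s = Suc p" using l_phase assms by simp
  show "s \<notin> range t"
    using assms strict_mono_less[OF t_strict] by auto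
qed

lemma x_below_phase:
  assumes "t p < s" "s < t (Suc p)" "1 \<le> j" "j < Suc p"
  shows "x s j = 0"
  using x_min[of s "Suc p" j] in_phase[OF assms(1,2)] assms(3,4) by simp

text \<open>By \<open>K_bound\<close> the terms are dominated by \<open>\<kappa> * i\<close> times
  those of the mass.\<close>

lemma flux_summable:
  assumes "1 \<le> i" "0 \<le> s" "s \<le> t m"
  shows "summable (\<lambda>k. K i (i + k) * x s (i + k))"
proof (rule summable_comparison_test')
  have "summable (\<lambda>k. real (k + i) * \<bar>x s (k + i)\<bar>)"
    using x_summable[OF assms(2,3)] by (subst summable_iff_shift)
  then show "summable (\<lambda>k. \<kappa> * real i * (real (i + k) * \<bar>x s (i + k)\<bar>))"
    by (intro summable_mult) (simp add: add.commute)
  show "norm (K i (i + k) * x s (i + k)) \<le> \<kappa> * real i * (real (i + k) * \<bar>x s (i + k)\<bar>)" for k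
  proof -
    have "\<bar>K i (i + k)\<bar> * \<bar>x s (i + k)\<bar> \<le> (\<kappa> * real i * real (i + k)) * \<bar>x s (i + k)\<bar>"
      using assms K_nonneg[of i "i + k"] K_bound[of i "i + k"] by (intro mult_right_mono) auto
    then show ?thesis by (simp add: abs_mult mult.assoc)
  qed
qed

text \<open>Differentiating the finite sum coordinatewise and applying
  \<open>bvec_weighted_sums\<close> gives a series over the merging partners
  \<open>Suc p + k\<close> of the minimal size; the product has size
  \<open>2 * Suc p + k\<close>.\<close>

lemma wsum_deriv:
  assumes s: "t p < s" "s < t (Suc p)" and supp: "\<And>j. M < j \<Longrightarrow> \<phi> j = 0"
  obtains D where "(wsum \<phi> M has_real_derivative D) (at s)"
    and "(\<lambda>k. K (Suc p) (Suc p + k) * x s (Suc p + k)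
            * (\<phi> (2 * Suc p + k) - \<phi> (Suc p + k) - \<phi> (Suc p))) sums D"
proof
  have "((\<lambda>r. x r j) has_real_derivative bvec K (Suc p) (x s) j) (at s)" if "1 \<le> j" for j
  proof -
    have "0 \<le> s \<and> ereal s < tinf t \<and> s \<notin> range t"
      using in_phase[OF s] less_tinf by blast
    moreover have "\<forall>s. 0 \<le> s \<and> ereal s < tinf t \<and> s \<notin> range t \<longrightarrow>
        (\<forall>j\<ge>1. ((\<lambda>r. x r j) has_real_derivative bvec K (l s) (x s) j) (at s))"
      using sol unfolding is_mdc_solution_def by (elim conjE) assumption
    ultimately show ?thesis using in_phase(3)[OF s] that by metis
  qed
  then show "(wsum \<phi> M has_real_derivative (\<Sum>j=1..M. \<phi> j * bvec K (Suc p) (x s) j)) (at s)"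
    unfolding wsum_def by (intro DERIV_sum DERIV_cmult) auto
  show "(\<lambda>k. K (Suc p) (Suc p + k) * x s (Suc p + k)
            * (\<phi> (2 * Suc p + k) - \<phi> (Suc p + k) - \<phi> (Suc p))) sums
          (\<Sum>j=1..M. \<phi> j * bvec K (Suc p) (x s) j)"
    using x_below_phase[OF s] supp K_sym[of _ "Suc p"] flux_summable[of "Suc p"] in_phase(1,2)[OF s]
    by (intro bvec_weighted_sums) simp_all
qed

lemma wsum_tail_sums:
  assumes s: "t p < s" "s < t (Suc p)" and supp: "\<And>j. M < j \<Longrightarrow> \<phi> j = 0"
  shows "(\<lambda>k. \<phi> (Suc p + k) * x s (Suc p + k)) sums wsum \<phi> M s"
  unfolding wsum_def by (rule weighted_tail_sums) (use x_below_phase[OF s] supp in auto)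

lemma flux_nonneg:
  assumes s: "t p < s" "s < t (Suc p)"
  shows "0 \<le> x s (Suc p + k)" "0 \<le> K (Suc p) (Suc p + k)"
  using x_nonneg[of s "Suc p"] K_nonneg in_phase[OF s] by auto

section \<open>Mass does not increase\<close>

text \<open>The truncated weight \<open>\<phi>\<close> is subadditive: a merger preserves it if the
  product has size at most \<open>R\<close> and otherwise cannot raise it. So the truncated mass
  decreases from a value at most \<open>norm11 x0\<close>.\<close>

lemma partial_mass_le_1:
  assumes s: "0 \<le> s" "s \<le> t m"
  shows "(\<Sum>j=1..R. real j * x s j) \<le> 1"
proof -
  define \<phi> where "\<phi> j = (if j \<le> R then real j else 0)" for j
  have "wsum \<phi> R s \<le> wsum \<phi> R 0"
  proof (rule piecewise_antimono[OF t_strict, of 0 m "wsum \<phi> R"])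
    show "continuous_on {t 0..t m} (wsum \<phi> R)" by (simp add: t_0 wsum_continuous)
    show "\<exists>D. (wsum \<phi> R has_real_derivative D) (at r) \<and> D \<le> 0"
      if r: "t p < r" "r < t (Suc p)" for p r
    proof -
      obtain D where D: "(wsum \<phi> R has_real_derivative D) (at r)"
        and sums: "(\<lambda>k. K (Suc p) (Suc p + k) * x r (Suc p + k)
            * (\<phi> (2 * Suc p + k) - \<phi> (Suc p + k) - \<phi> (Suc p))) sums D"
        using r by (rule wsum_deriv[of _ _ R \<phi>]) (auto simp: \<phi>_def)
      have "D \<le> 0"
      proof (rule sums_le[OF _ sums sums_zero])
        show "K (Suc p) (Suc p + k) * x r (Suc p + k)
            * (\<phi> (2 * Suc p + k) - \<phi> (Suc p + k) - \<phi> (Suc p)) \<le> 0" for k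
          using flux_nonneg[OF r] by (intro mult_nonneg_nonpos mult_nonneg_nonneg) (auto simp: \<phi>_def)
      qed
      then show ?thesis using D by blast
    qed
  qed (use s t_0 in auto)
  moreover have "wsum \<phi> R r = (\<Sum>j=1..R. real j * x r j)" for r
    unfolding wsum_def \<phi>_def by (rule sum.cong) auto
  moreover have "(\<Sum>j=1..R. real j * x0 j) \<le> 1"
  proof -
    have "(\<Sum>j=1..R. real j * x0 j) = (\<Sum>j=1..R. real j * \<bar>x0 j\<bar>)"
      using x0_nonneg by (intro sum.cong) auto
    also have "\<dots> \<le> norm11 x0"
      unfolding norm11_def using x0_X11 by (intro sum_le_suminf) (auto simp: in_X11_def)
    finally show ?thesis using x0_norm by simp
  qed
  ultimately show ?thesis by (simp add: x_0)
qed

lemma mass_tail: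
  assumes s: "0 \<le> s" "s \<le> t m" and i: "1 \<le> i"
  obtains m1 where "(\<lambda>k. real (i + k) * x s (i + k)) sums m1" "m1 \<le> 1"
proof
  have eq: "real (i + k) * x s (i + k) = real (k + i) * \<bar>x s (k + i)\<bar>" for k
    using x_nonneg[OF s, of "i + k"] i by (simp add: add.commute)
  have summ: "summable (\<lambda>k. real (i + k) * x s (i + k))"
    unfolding eq using x_summable[OF s]
    by (subst summable_iff_shift[of "\<lambda>j. real j * \<bar>x s j\<bar>"])
  then show "(\<lambda>k. real (i + k) * x s (i + k)) sums (\<Sum>k. real (i + k) * x s (i + k))"
    by (rule summable_sums)
  show "(\<Sum>k. real (i + k) * x s (i + k)) \<le> 1"
  proof (rule suminf_le_const[OF summ])
    fix n
    have "(\<Sum>k<n. real (i + k) * x s (i + k)) = (\<Sum>j=i..<i+n. real j * x s j)"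
      by (rule sum.reindex_bij_witness[of _ "\<lambda>j. j - i" "\<lambda>k. i + k"]) auto
    also have "\<dots> \<le> (\<Sum>j=1..i+n. real j * x s j)"
      using x_nonneg[OF s] i by (intro sum_mono2) auto
    also have "\<dots> \<le> 1" by (rule partial_mass_le_1[OF s])
    finally show "(\<Sum>k<n. real (i + k) * x s (i + k)) \<le> 1" .
  qed
qed

section \<open>Slow decay of the number of clusters excludes blow-up\<close>

text \<open>A merger removes one cluster, up to cutoff errors of order \<open>1 / L\<close> paid for
  by the mass. Hence \<open>W' \<ge> - c * (W + \<epsilon>)\<close> for the truncated count
  \<open>W\<close>, and \<open>(W + \<epsilon>) * exp (c * s)\<close> does not decrease.\<close>

lemma phase_count_decay:
  assumes ub: "\<And>j. Suc p \<le> j \<Longrightarrow> K (Suc p) j \<le> c" and L: "0 < L"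
    and \<epsilon>: "(1 + real (Suc p)) / real L \<le> \<epsilon>"
  shows "(wsum (cutoff L) (2 * L) (t p) + \<epsilon>) * exp (- c * (t (Suc p) - t p))
           \<le> wsum (cutoff L) (2 * L) (t (Suc p)) + \<epsilon>"
proof -
  define W where "W = wsum (cutoff L) (2 * L)"
  \<comment> \<open>The minus sign turns the growth claim into the form of
    \<open>piecewise_antimono\<close>.\<close>
  define h where "h s = - ((W s + \<epsilon>) * exp (c * s))" for s
  have c: "0 \<le> c" using K_nonneg[of "Suc p" "Suc p"] ub[of "Suc p"] by simp
  have cont: "continuous_on {t p..t (Suc p)} W"
    unfolding W_def by (rule wsum_continuous) (rule t_nonneg)
  have "h (t (Suc p)) \<le> h (t p)"
  proof (rule piecewise_antimono[OF t_strict, of p "Suc p" h])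
    show "continuous_on {t p..t (Suc p)} h"
      unfolding h_def by (intro continuous_intros cont)
    fix p' s assume "p \<le> p'" "p' < Suc p" and s': "t p' < s" "s < t (Suc p')"
    then have s: "t p < s" "s < t (Suc p)" by (auto simp: less_Suc_eq_le dest: order_antisym)
    obtain D where D: "(W has_real_derivative D) (at s)"
      and sums: "(\<lambda>k. K (Suc p) (Suc p + k) * x s (Suc p + k)
            * (cutoff L (2 * Suc p + k) - cutoff L (Suc p + k) - cutoff L (Suc p))) sums D"
      unfolding W_def using s by (rule wsum_deriv[of _ _ "2 * L" "cutoff L"]) (auto simp: cutoff_eq_0 L)
    obtain m1 where m1: "(\<lambda>k. real (Suc p + k) * x s (Suc p + k)) sums m1" "m1 \<le> 1"
      using mass_tail[of s "Suc p" "Suc p"] in_phase[OF s] by auto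
    have Ws: "(\<lambda>k. cutoff L (Suc p + k) * x s (Suc p + k)) sums W s"
      unfolding W_def by (rule wsum_tail_sums[OF s]) (simp add: cutoff_eq_0 L)
    \<comment> \<open>With \<open>i = Suc p\<close>, a merger with size \<open>j\<close> costs
      weight at most \<open>1 + i / L\<close>. Since \<open>1 \<le> cutoff L j + j / L\<close> and
      \<open>i / L \<le> i * j / L\<close>, this is at most \<open>cutoff L j + r * j\<close>, whose
      sum against \<open>x s j\<close> is bounded by count and mass.\<close>
    define r where "r = (1 + real (Suc p)) / real L"
    have lhs: "(\<lambda>k. - c * (cutoff L (Suc p + k) * x s (Suc p + k)
             + r * (real (Suc p + k) * x s (Suc p + k)))) sums (- c * (W s + r * m1))"
      by (intro sums_mult sums_add Ws m1)
    have "- c * (W s + r * m1) \<le> D"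
    proof (rule sums_le[OF _ lhs sums])
      fix k
      define j where "j = Suc p + k"
      have xj: "0 \<le> x s j" "0 \<le> K (Suc p) j" using flux_nonneg[OF s] by (auto simp: j_def)
      have "(cutoff L j - real (Suc p) / real L) - cutoff L j - 1
          \<le> cutoff L (j + Suc p) - cutoff L j - cutoff L (Suc p)"
        using cutoff_add_ge[of L j "Suc p"] cutoff_bounds(2)[of L "Suc p"] by linarith
      moreover have "1 \<le> cutoff L j + real j / real L" using one_minus_cutoff_le[of L j] by simp
      moreover have "real (Suc p) / real L \<le> real (Suc p) * real j / real L"
        by (intro divide_right_mono) (auto simp: j_def mult_le_cancel_left1)
      moreover have "r * real j = real j / real L + real (Suc p) * real j / real L"
        by (simp add: r_def add_divide_distrib distrib_right)
      ultimately have br: "- (cutoff L j + r * real j)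
          \<le> cutoff L (j + Suc p) - cutoff L j - cutoff L (Suc p)"
        by linarith
      have r0: "0 \<le> cutoff L j + r * real j" using cutoff_bounds(1)[of L j] by (simp add: r_def)
      have "K (Suc p) j * x s j * (cutoff L j + r * real j) \<le> c * x s j * (cutoff L j + r * real j)"
        using ub[of j] xj r0 by (intro mult_right_mono) (auto simp: j_def)
      moreover have "K (Suc p) j * x s j * (- (cutoff L j + r * real j))
          \<le> K (Suc p) j * x s j * (cutoff L (j + Suc p) - cutoff L j - cutoff L (Suc p))"
        using br xj by (intro mult_left_mono) auto
      moreover have jj: "2 * Suc p + k = j + Suc p" by (simp add: j_def)
      ultimately show "- c * (cutoff L (Suc p + k) * x s (Suc p + k)
             + r * (real (Suc p + k) * x s (Suc p + k)))
          \<le> K (Suc p) (Suc p + k) * x s (Suc p + k)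
            * (cutoff L (2 * Suc p + k) - cutoff L (Suc p + k) - cutoff L (Suc p))"
        unfolding jj j_def[symmetric] by (simp add: algebra_simps)
    qed
    moreover have "r * m1 \<le> \<epsilon>"
    proof -
      have "r * m1 \<le> r * 1" using m1 by (intro mult_left_mono) (auto simp: r_def)
      then show ?thesis using \<epsilon> by (simp add: r_def)
    qed
    ultimately have "- c * (W s + \<epsilon>) \<le> D"
      using mult_left_mono[of "W s + r * m1" "W s + \<epsilon>" c] c by simp
    then have "- ((D + c * (W s + \<epsilon>)) * exp (c * s)) \<le> 0" by simp
    moreover have "(h has_real_derivative - ((D + c * (W s + \<epsilon>)) * exp (c * s))) (at s)"
      unfolding h_def by (auto intro!: derivative_eq_intros D simp: algebra_simps)
    ultimately show "\<exists>D. (h has_real_derivative D) (at s) \<and> D \<le> 0" by blast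
  qed (use strict_mono_less_eq[OF t_strict, of p "Suc p"] in auto)
  then have "(W (t p) + \<epsilon>) * exp (c * t p) * exp (- c * t (Suc p))
      \<le> (W (t (Suc p)) + \<epsilon>) * exp (c * t (Suc p)) * exp (- c * t (Suc p))"
    unfolding h_def by (intro mult_right_mono) auto
  then show ?thesis unfolding W_def mult.assoc exp_add[symmetric] by (simp add: algebra_simps)
qed

text \<open>Multiplying the decay bounds of the first \<open>m\<close> phases keeps the count at
  \<open>t m\<close> above \<open>x0 1 * exp (- E m)\<close>, up to truncation. All sizes are then
  at least \<open>m + 1\<close> and the mass is at most 1, so the count is at most
  \<open>1 / (m + 1)\<close>. Taking logarithms gives the claim.\<close>

lemma log_size_le:
  assumes ub: "\<And>i j. 1 \<le> i \<Longrightarrow> i \<le> j \<Longrightarrow> K i j \<le> C * ln (real i + 1)"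
  shows "ln (real m + 1) \<le> - ln (x0 1) + C * (\<Sum>p<m. ln (real p + 2) * (t (Suc p) - t p))"
proof -
  \<comment> \<open>Phase \<open>p\<close> has minimal size \<open>p + 1\<close>, whence
    \<open>ln (p + 2)\<close>.\<close>
  define E where "E q = (\<Sum>p<q. C * ln (real p + 2) * (t (Suc p) - t p))" for q
  have bound: "x0 1 * exp (- E m) \<le> 1 / (real m + 1) + (1 + real m) / real L" if L: "1 \<le> L" for L
  proof -
    define \<epsilon> where "\<epsilon> = (1 + real m) / real L"
    define W where "W = wsum (cutoff L) (2 * L)"
    have "(W 0 + \<epsilon>) * exp (- E q) \<le> W (t q) + \<epsilon>" if "q \<le> m" for q
      using that
    proof (induction q)
      case 0
      then show ?case by (simp add: E_def t_0)
    next
      case (Suc q)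
      have "(W 0 + \<epsilon>) * exp (- E (Suc q))
          = (W 0 + \<epsilon>) * exp (- E q) * exp (- (C * ln (real q + 2)) * (t (Suc q) - t q))"
        by (simp add: E_def mult.assoc exp_add[symmetric])
      also have "\<dots> \<le> (W (t q) + \<epsilon>) * exp (- (C * ln (real q + 2)) * (t (Suc q) - t q))"
        using Suc by (intro mult_right_mono) auto
      also have "\<dots> \<le> W (t (Suc q)) + \<epsilon>"
        unfolding W_def
      proof (rule phase_count_decay)
        show "K (Suc q) j \<le> C * ln (real q + 2)" if "Suc q \<le> j" for j
          using ub[of "Suc q" j] that by (simp add: add.commute)
        show "(1 + real (Suc q)) / real L \<le> \<epsilon>"
          unfolding \<epsilon>_def using Suc.prems by (intro divide_right_mono) auto
      qed (use L in simp)
      finally show ?case .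
    qed
    from this[of m] have 1: "(W 0 + \<epsilon>) * exp (- E m) \<le> W (t m) + \<epsilon>" by simp
    have "x0 1 \<le> W 0"
    proof -
      have "x0 1 = (\<Sum>j\<in>{1}. cutoff L j * x 0 j)" using L by (simp add: cutoff_eq_1 x_0)
      also have "\<dots> \<le> W 0"
        unfolding W_def wsum_def using L x0_nonneg cutoff_bounds(1)
        by (intro sum_mono2) (auto simp: x_0)
      finally show ?thesis .
    qed
    moreover have "0 \<le> \<epsilon>" by (simp add: \<epsilon>_def)
    ultimately have 2: "x0 1 * exp (- E m) \<le> (W 0 + \<epsilon>) * exp (- E m)"
      by (intro mult_right_mono) auto
    \<comment> \<open>At time \<open>t m\<close> phase \<open>m\<close> has already begun, so the
      minimal size there is \<open>m + 1\<close>.\<close>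
    have tm: "t m < t (Suc m)" using t_strict by (simp add: strict_mono_less)
    have "(real m + 1) * W (t m) \<le> (\<Sum>j=1..2*L. real j * x (t m) j)"
      unfolding W_def wsum_def sum_distrib_left
    proof (rule sum_mono)
      fix j assume j: "j \<in> {1..2*L}"
      show "(real m + 1) * (cutoff L j * x (t m) j) \<le> real j * x (t m) j"
      proof (cases "j < Suc m")
        case True
        then show ?thesis
          using x_min[OF t_nonneg, of m m j] l_phase[of m "t m"] tm j by simp
      next
        case False
        have xj: "0 \<le> x (t m) j" using x_nonneg[OF t_nonneg, of m m j] j by simp
        have "(real m + 1) * cutoff L j \<le> real j * 1"
          using False cutoff_bounds[of L j] by (intro mult_mono) auto
        then have "(real m + 1) * cutoff L j * x (t m) j \<le> real j * 1 * x (t m) j"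
          using xj by (rule mult_right_mono)
        then show ?thesis by (simp add: mult.assoc)
      qed
    qed
    also have "\<dots> \<le> 1" by (rule partial_mass_le_1[OF t_nonneg order_refl])
    finally have "W (t m) \<le> 1 / (real m + 1)" by (simp add: field_simps)
    then show ?thesis using 1 2 unfolding \<epsilon>_def by linarith
  qed
  \<comment> \<open>For fixed \<open>m\<close> the truncation error vanishes as \<open>L\<close>
    grows.\<close>
  have "(\<lambda>L. 1 / (real m + 1) + (1 + real m) / real L) \<longlonglongrightarrow> 1 / (real m + 1) + 0"
    by (intro tendsto_intros lim_const_over_n)
  then have "x0 1 * exp (- E m) \<le> 1 / (real m + 1) + 0"
    by (rule tendsto_lowerbound)
       (use bound in \<open>auto intro!: eventually_sequentiallyI[of 1]\<close>)
  then have "ln (x0 1 * exp (- E m)) \<le> ln (1 / (real m + 1))"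
    using x0_1 by (intro ln_mono) auto
  then have "ln (x0 1) - E m \<le> - ln (real m + 1)"
    using x0_1 by (simp add: ln_mult ln_div)
  then show ?thesis by (simp add: E_def sum_distrib_left mult.assoc)
qed

text \<open>Discrete Gronwall: if the times stayed below \<open>T\<close>, the majorant
  \<open>U m\<close> of \<open>ln (m + 1)\<close> would satisfy
  \<open>U (Suc m) \<le> U m * (1 + C * d m)\<close> and thus be bounded by
  \<open>U0 * exp (C * T)\<close>, which is absurd for large \<open>m\<close>.\<close>

theorem tinf_infinite:
  assumes C: "0 \<le> C" and ub: "\<And>i j. 1 \<le> i \<Longrightarrow> i \<le> j \<Longrightarrow> K i j \<le> C * ln (real i + 1)"
  shows "tinf t = \<infinity>"
proof (rule ccontr)
  assume "tinf t \<noteq> \<infinity>"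
  moreover have "tinf t \<noteq> -\<infinity>" using less_tinf[of "t 0" 0] by auto
  ultimately obtain T where T: "tinf t = ereal T" by (cases "tinf t") auto
  have tT: "t m \<le> T" for m using less_tinf[of "t m" m] T by simp
  define d where "d p = t (Suc p) - t p" for p
  have d: "0 \<le> d p" for p using strict_mono_less_eq[OF t_strict, of p "Suc p"] by (simp add: d_def)
  have dsum: "(\<Sum>p<m. d p) = t m" for m unfolding d_def by (simp add: sum_lessThan_telescope t_0)
  \<comment> \<open>Replacing \<open>ln (p + 2)\<close> by \<open>ln (p + 1) + ln 2\<close> costs at
    most \<open>C * ln 2 * T\<close> in total. After it the increment of \<open>U\<close> over phase
    \<open>p\<close> involves \<open>ln (p + 1)\<close>, which \<open>U p\<close> itself
    bounds.\<close>
  define U0 where "U0 = - ln (x0 1) + C * ln 2 * T"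
  define U where "U m = U0 + C * (\<Sum>p<m. ln (real p + 1) * d p)" for m
  have LU: "ln (real m + 1) \<le> U m" for m
  proof -
    have "(\<Sum>p<m. ln (real p + 2) * d p) \<le> (\<Sum>p<m. ln (real p + 1) * d p + ln 2 * d p)"
    proof (rule sum_mono)
      fix p
      have "ln (real p + 2) \<le> ln ((real p + 1) * 2)" by (intro ln_mono) auto
      also have "\<dots> = ln (real p + 1) + ln 2" by (rule ln_mult_pos) auto
      finally show "ln (real p + 2) * d p \<le> ln (real p + 1) * d p + ln 2 * d p"
        using d[of p] mult_right_mono by (fastforce simp: distrib_right[symmetric])
    qed
    also have "\<dots> = (\<Sum>p<m. ln (real p + 1) * d p) + ln 2 * t m"
      by (simp add: sum.distrib sum_distrib_left[symmetric] dsum)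
    also have "\<dots> \<le> (\<Sum>p<m. ln (real p + 1) * d p) + ln 2 * T"
      using tT[of m] by simp
    finally have "C * (\<Sum>p<m. ln (real p + 2) * d p) \<le> C * ((\<Sum>p<m. ln (real p + 1) * d p) + ln 2 * T)"
      using C by (rule mult_left_mono)
    then show ?thesis
      using log_size_le[OF ub, of m] by (simp add: U_def U0_def d_def distrib_left)
  qed
  have U_exp: "U m \<le> U0 * exp (C * t m)" for m
  proof (induction m)
    case 0
    then show ?case by (simp add: U_def t_0)
  next
    case (Suc m)
    have Um: "0 \<le> U m" using LU[of m] ln_ge_zero[of "real m + 1"] by linarith
    have "U (Suc m) = U m + C * d m * ln (real m + 1)" by (simp add: U_def algebra_simps)
    also have "\<dots> \<le> U m + C * d m * U m"
      using LU[of m] C d[of m] by (intro add_left_mono mult_left_mono) auto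
    also have "\<dots> = U m * (1 + C * d m)" by (simp add: algebra_simps)
    also have "\<dots> \<le> U m * exp (C * d m)" using Um by (intro mult_left_mono exp_ge_add_one_self)
    also have "\<dots> \<le> U0 * exp (C * t m) * exp (C * d m)" using Suc by (intro mult_right_mono) auto
    also have "\<dots> = U0 * exp (C * t (Suc m))"
      by (simp add: d_def mult.assoc exp_add[symmetric] algebra_simps)
    finally show ?case .
  qed
  have U0: "0 \<le> U0" using LU[of 0] by (simp add: U_def)
  define B where "B = U0 * exp (C * T)"
  have B: "ln (real m + 1) \<le> B" for m
  proof -
    have "U0 * exp (C * t m) \<le> B"
      unfolding B_def using U0 C tT[of m] by (intro mult_left_mono) (auto intro: mult_left_mono)
    then show ?thesis using LU[of m] U_exp[of m] by linarith
  qed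
  obtain m :: nat where "exp B < real m" using reals_Archimedean2 by blast
  then have "B < ln (real m + 1)" by (subst ln_exp[of B, symmetric], subst ln_less_cancel_iff) (auto simp del: ln_exp intro: add_pos_pos)
  then show False using B[of m] by simp
qed

section \<open>Duration of a block of minimal sizes\<close>

text \<open>The ratio \<open>Q / N\<close> of the overview is replaced by the two quantities \<open>exp (c s) N\<close> and
  \<open>exp (c s) Q\<close>, both built with the Lipschitz cutoff: it makes the truncation error in \<open>Q'\<close>
  at most the mass times \<open>O(1 / L)\<close>, although moments above the first may be infinite.\<close>

lemma block_duration:
  assumes n: "1 \<le> n" and c: "0 < c" and lb: "\<And>i j. n \<le> i \<Longrightarrow> n \<le> j \<Longrightarrow> c \<le> K i j"
  shows "t (2 * n - 1) - t (n - 1) \<le> 1 / c"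
proof -
  define a where "a = t (n - 1)"
  define T where "T = t (2 * n - 1)"
  have aT: "a \<le> T" unfolding a_def T_def using t_strict by (simp add: strict_mono_less_eq)
  have a0: "0 \<le> a" "0 \<le> T" by (simp_all add: a_def T_def t_nonneg)
  have lT: "l T = 2 * n"
    using l_phase[of "2 * n - 1" T] n t_strict by (simp add: T_def strict_mono_less)
  \<comment> \<open>A positive lower bound for \<open>Q T\<close> independent of \<open>L\<close>;
    it survives the limit in \<open>L\<close> and is divided out at the end.\<close>
  define y where "y = x T (2 * n)"
  have y: "0 < y"
    using x_l[OF a0(2), of "2 * n - 1"] x_nonneg[OF a0(2), of "2 * n - 1" "2 * n"] n lT
    by (simp add: y_def T_def)
  \<comment> \<open>\<open>4 * n \<le> L\<close> makes the cutoff 1 on every product of two sizes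
    below \<open>2 * n\<close>.\<close>
  have bound: "((T - a) * c - 1) * y \<le> (T - a) * (4 * real n ^ 2 * \<kappa>) / real L" if L: "4 * n \<le> L" for L
  proof -
    have L0: "0 < L" using L n by simp
    define \<psi> where "\<psi> j = (if j < 2 * n then 0 else cutoff L j)" for j
    define N where "N = wsum (cutoff L) (2 * L)"
    define Q where "Q = wsum \<psi> (2 * L)"
    define \<epsilon> where "\<epsilon> = 4 * real n ^ 2 * \<kappa> / real L"
    have \<epsilon>0: "0 \<le> \<epsilon>" using kappa_pos by (simp add: \<epsilon>_def)
    have supp: "cutoff L j = 0" "\<psi> j = 0" if "2 * L < j" for j
      using that L0 by (auto simp: \<psi>_def cutoff_eq_0)
    have cont: "continuous_on {a..T} N" "continuous_on {a..T} Q"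
      unfolding N_def Q_def T_def using wsum_continuous a0 by auto
    have phase: "n \<le> Suc p \<and> Suc p < 2 * n" if "n - 1 \<le> p" "p < 2 * n - 1" for p
      using that n by auto
    \<comment> \<open>No truncation error arises here: the cutoff is antitone and equals 1 at the
      minimal size, so each merger lowers the weight by at least 1.\<close>
    have N_deriv: "\<exists>D. (N has_real_derivative D) (at s) \<and> D \<le> - c * N s"
      if p: "n \<le> Suc p" "Suc p < 2 * n" and s: "t p < s" "s < t (Suc p)" for p s
    proof -
      obtain D where D: "(N has_real_derivative D) (at s)"
        and sums: "(\<lambda>k. K (Suc p) (Suc p + k) * x s (Suc p + k)
            * (cutoff L (2 * Suc p + k) - cutoff L (Suc p + k) - cutoff L (Suc p))) sums D"
        unfolding N_def using s by (rule wsum_deriv[of _ _ "2 * L" "cutoff L"]) (auto simp: supp)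
      have rhs: "(\<lambda>k. - c * (cutoff L (Suc p + k) * x s (Suc p + k))) sums (- c * N s)"
        unfolding N_def by (intro sums_mult wsum_tail_sums[OF s] supp)
      have "D \<le> - c * N s"
      proof (rule sums_le[OF _ sums rhs])
        fix k
        define j where "j = Suc p + k"
        have xj: "0 \<le> x s j" "0 \<le> K (Suc p) j" using flux_nonneg[OF s] by (auto simp: j_def)
        have "cutoff L (j + Suc p) - cutoff L j - cutoff L (Suc p) \<le> - 1"
          using cutoff_antimono[of j "j + Suc p" L] cutoff_eq_1[of "Suc p" L] p L by simp
        then have "K (Suc p) j * x s j * (cutoff L (j + Suc p) - cutoff L j - cutoff L (Suc p))
            \<le> K (Suc p) j * x s j * (- 1)"
          using xj by (intro mult_left_mono) auto
        moreover have "c * (cutoff L j * x s j) \<le> K (Suc p) j * (1 * x s j)"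
          using lb[of "Suc p" j] p xj c cutoff_bounds[of L j]
          by (intro mult_mono) (auto simp: j_def)
        moreover have jj: "2 * Suc p + k = j + Suc p" by (simp add: j_def)
        ultimately show "K (Suc p) (Suc p + k) * x s (Suc p + k)
            * (cutoff L (2 * Suc p + k) - cutoff L (Suc p + k) - cutoff L (Suc p))
            \<le> - c * (cutoff L (Suc p + k) * x s (Suc p + k))"
          unfolding jj j_def[symmetric] by simp
      qed
      then show ?thesis using D by blast
    qed
    \<comment> \<open>A partner below \<open>2 * n\<close> yields a product of size at least
      \<open>2 * n\<close>, which adds 1 to \<open>Q\<close>. A larger partner is already counted,
      and only the slope of the cutoff can lower its weight.\<close>
    have Q_deriv: "\<exists>D. (Q has_real_derivative D) (at s) \<and> c * (N s - Q s) - \<epsilon> \<le> D"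
      if p: "n \<le> Suc p" "Suc p < 2 * n" and s: "t p < s" "s < t (Suc p)" for p s
    proof -
      obtain D where D: "(Q has_real_derivative D) (at s)"
        and sums: "(\<lambda>k. K (Suc p) (Suc p + k) * x s (Suc p + k)
            * (\<psi> (2 * Suc p + k) - \<psi> (Suc p + k) - \<psi> (Suc p))) sums D"
        unfolding Q_def using s by (rule wsum_deriv[of _ _ "2 * L" \<psi>]) (auto simp: supp)
      obtain m1 where m1: "(\<lambda>k. real (Suc p + k) * x s (Suc p + k)) sums m1" "m1 \<le> 1"
        using mass_tail[of s "Suc p" "Suc p"] in_phase[OF s] by auto
      \<comment> \<open>\<open>K_bound\<close> times the cutoff loss \<open>Suc p / L\<close> gives
        at most \<open>r * j\<close>; as \<open>Suc p < 2 * n\<close> and the mass is at most 1, the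
        total error is at most \<open>\<epsilon>\<close>.\<close>
      define r where "r = \<kappa> * real (Suc p) * (real (Suc p) / real L)"
      have r0: "0 \<le> r" using kappa_pos by (simp add: r_def)
      have lhs: "(\<lambda>k. c * (cutoff L (Suc p + k) * x s (Suc p + k) - \<psi> (Suc p + k) * x s (Suc p + k))
            - r * (real (Suc p + k) * x s (Suc p + k))) sums (c * (N s - Q s) - r * m1)"
        unfolding N_def Q_def by (intro sums_mult sums_diff wsum_tail_sums[OF s] supp m1)
      have "c * (N s - Q s) - r * m1 \<le> D"
      proof (rule sums_le[OF _ lhs sums])
        fix k
        define j where "j = Suc p + k"
        have xj: "0 \<le> x s j" "0 \<le> K (Suc p) j" using flux_nonneg[OF s] by (auto simp: j_def)
        have "c * (cutoff L j * x s j - \<psi> j * x s j) - r * (real j * x s j)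
            \<le> K (Suc p) j * x s j * (\<psi> (j + Suc p) - \<psi> j - \<psi> (Suc p))"
        proof (cases "j < 2 * n")
          case True
          then have "\<psi> (j + Suc p) = 1" "\<psi> j = 0" "\<psi> (Suc p) = 0" "cutoff L j = 1"
            using p L by (auto simp: \<psi>_def j_def cutoff_eq_1)
          moreover have "c * x s j \<le> K (Suc p) j * x s j"
            using lb[of "Suc p" j] p xj by (intro mult_right_mono) (auto simp: j_def)
          moreover have "0 \<le> r * (real j * x s j)" using r0 xj by simp
          ultimately show ?thesis by simp
        next
          case False
          then have \<psi>: "\<psi> (j + Suc p) = cutoff L (j + Suc p)" "\<psi> j = cutoff L j" "\<psi> (Suc p) = 0"
            using p by (auto simp: \<psi>_def)
          have "K (Suc p) j * x s j * (real (Suc p) / real L)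
              \<le> \<kappa> * real (Suc p) * real j * x s j * (real (Suc p) / real L)"
            using K_bound[of "Suc p" j] xj by (intro mult_right_mono) (auto simp: j_def)
          moreover have "K (Suc p) j * x s j * (- (real (Suc p) / real L))
              \<le> K (Suc p) j * x s j * (cutoff L (j + Suc p) - cutoff L j)"
            using cutoff_add_ge[of L j "Suc p"] xj by (intro mult_left_mono) auto
          ultimately show ?thesis unfolding \<psi> r_def by (simp add: mult_ac)
        qed
        moreover have jj: "2 * Suc p + k = j + Suc p" by (simp add: j_def)
        ultimately show "c * (cutoff L (Suc p + k) * x s (Suc p + k) - \<psi> (Suc p + k) * x s (Suc p + k))
            - r * (real (Suc p + k) * x s (Suc p + k))
            \<le> K (Suc p) (Suc p + k) * x s (Suc p + k)
              * (\<psi> (2 * Suc p + k) - \<psi> (Suc p + k) - \<psi> (Suc p))"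
          unfolding jj j_def[symmetric] by simp
      qed
      moreover have "r * m1 \<le> \<epsilon>"
      proof -
        have "real (Suc p) * real (Suc p) \<le> (2 * real n) * (2 * real n)"
          using p by (intro mult_mono) auto
        then have "\<kappa> * (real (Suc p) * real (Suc p)) / real L \<le> \<kappa> * ((2 * real n) * (2 * real n)) / real L"
          using kappa_pos by (intro divide_right_mono mult_left_mono) auto
        then have "r \<le> \<epsilon>" by (simp add: r_def \<epsilon>_def power2_eq_square mult_ac)
        moreover have "r * m1 \<le> r * 1" using m1 r0 by (intro mult_left_mono)
        ultimately show ?thesis by simp
      qed
      ultimately show ?thesis using D by (intro exI[of _ D]) auto
    qed
    \<comment> \<open>At time \<open>T\<close> the minimal size is \<open>2 * n\<close>, so both
      weights count the same clusters.\<close>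
    have NQ: "N T = Q T"
      unfolding N_def Q_def wsum_def
    proof (rule sum.cong)
      fix j assume "j \<in> {1..2 * L}"
      then show "cutoff L j * x T j = \<psi> j * x T j"
        using x_min[OF a0(2), of "2 * n - 1" j] lT by (auto simp: \<psi>_def T_def)
    qed simp
    have N_mono: "exp (c * T) * N T \<le> exp (c * s) * N s" if "a \<le> s" "s \<le> T" for s
    proof (rule piecewise_antimono[OF t_strict, of "n - 1" "2 * n - 1" "\<lambda>s. exp (c * s) * N s"])
      show "continuous_on {t (n - 1)..t (2 * n - 1)} (\<lambda>s. exp (c * s) * N s)"
        using cont unfolding a_def T_def by (intro continuous_intros)
      fix p s assume p: "n - 1 \<le> p" "p < 2 * n - 1" and s: "t p < s" "s < t (Suc p)"
      obtain D where D: "(N has_real_derivative D) (at s)" "D \<le> - c * N s"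
        using N_deriv[of p s] phase[OF p] s by blast
      have "((\<lambda>s. exp (c * s) * N s) has_real_derivative exp (c * s) * (D + c * N s)) (at s)"
        by (auto intro!: derivative_eq_intros D simp: algebra_simps)
      moreover have "exp (c * s) * (D + c * N s) \<le> 0"
        using D by (intro mult_nonneg_nonpos) auto
      ultimately show "\<exists>D. ((\<lambda>s. exp (c * s) * N s) has_real_derivative D) (at s) \<and> D \<le> 0" by blast
    qed (use that in \<open>auto simp: a_def T_def\<close>)
    \<comment> \<open>A constant lower bound for the derivative of \<open>exp (c * s) * Q s\<close>:
      that derivative is at least \<open>exp (c * s) * (c * N s - \<epsilon>)\<close>, where
      \<open>N_mono\<close> moves the first term to time \<open>T\<close>, \<open>NQ\<close>
      replaces \<open>N T\<close> by \<open>Q T\<close>, and the error is enlarged to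
      \<open>exp (c * T) * \<epsilon>\<close>.\<close>
    define C where "C = exp (c * T) * (c * Q T - \<epsilon>)"
    have "C * T - exp (c * T) * Q T \<le> C * a - exp (c * a) * Q a"
    proof (rule piecewise_antimono[OF t_strict, of "n - 1" "2 * n - 1" "\<lambda>s. C * s - exp (c * s) * Q s"])
      show "continuous_on {t (n - 1)..t (2 * n - 1)} (\<lambda>s. C * s - exp (c * s) * Q s)"
        using cont unfolding a_def T_def by (intro continuous_intros)
      fix p s assume p: "n - 1 \<le> p" "p < 2 * n - 1" and s: "t p < s" "s < t (Suc p)"
      obtain D where D: "(Q has_real_derivative D) (at s)" "c * (N s - Q s) - \<epsilon> \<le> D"
        using Q_deriv[of p s] phase[OF p] s by blast
      have "a \<le> t p" "t (Suc p) \<le> T"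
        unfolding a_def T_def using p t_strict by (auto simp: strict_mono_less_eq)
      then have sT: "a \<le> s" "s \<le> T" using s by auto
      have "((\<lambda>s. C * s - exp (c * s) * Q s) has_real_derivative C - exp (c * s) * (D + c * Q s)) (at s)"
        by (auto intro!: derivative_eq_intros D simp: algebra_simps)
      moreover have "C - exp (c * s) * (D + c * Q s) \<le> 0"
      proof -
        have "exp (c * s) * (c * N s - \<epsilon>) \<le> exp (c * s) * (D + c * Q s)"
          using D by (intro mult_left_mono) (auto simp: algebra_simps)
        moreover have "c * (exp (c * T) * N T) \<le> c * (exp (c * s) * N s)"
          using N_mono[OF sT] c by (intro mult_left_mono) auto
        moreover have "exp (c * s) * \<epsilon> \<le> exp (c * T) * \<epsilon>"
          using sT c \<epsilon>0 by (intro mult_right_mono) auto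
        ultimately show ?thesis by (simp add: C_def NQ algebra_simps)
      qed
      ultimately show "\<exists>D. ((\<lambda>s. C * s - exp (c * s) * Q s) has_real_derivative D) (at s) \<and> D \<le> 0"
        by blast
    qed (use aT in \<open>auto simp: a_def T_def\<close>)
    moreover have "0 \<le> Q a"
      unfolding Q_def wsum_def using x_nonneg[OF a0(1), of "n - 1"] cutoff_bounds(1)
      by (intro sum_nonneg mult_nonneg_nonneg) (auto simp: \<psi>_def a_def)
    then have "0 \<le> exp (c * a) * Q a" by simp
    ultimately have "C * (T - a) \<le> exp (c * T) * Q T"
      unfolding right_diff_distrib by linarith
    then have "exp (c * T) * ((c * Q T - \<epsilon>) * (T - a)) \<le> exp (c * T) * Q T"
      by (simp add: C_def mult.assoc)
    then have "(c * Q T - \<epsilon>) * (T - a) \<le> Q T" by (simp only: mult_le_cancel_left_pos exp_gt_zero)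
    then have *: "((T - a) * c - 1) * Q T \<le> (T - a) * \<epsilon>"
      by (simp add: algebra_simps)
    have "y \<le> Q T"
    proof -
      have "y = (\<Sum>j\<in>{2 * n}. \<psi> j * x T j)" using L by (simp add: \<psi>_def y_def cutoff_eq_1)
      also have "\<dots> \<le> Q T"
        unfolding Q_def wsum_def
        using x_nonneg[OF a0(2), of "2 * n - 1"] cutoff_bounds(1) n L
        by (intro sum_mono2 mult_nonneg_nonneg) (auto simp: \<psi>_def T_def)
      finally show ?thesis .
    qed
    show ?thesis
    \<comment> \<open>Replacing \<open>Q T\<close> by the smaller \<open>y\<close> needs a
      nonnegative factor; for a nonpositive one the claim is immediate.\<close>
    proof (cases "(T - a) * c - 1 \<le> 0")
      case True
      then have "((T - a) * c - 1) * y \<le> 0" using y by (simp add: mult_nonpos_nonneg)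
      also have "0 \<le> (T - a) * \<epsilon>" using aT \<epsilon>0 by simp
      finally show ?thesis by (simp add: \<epsilon>_def)
    next
      case False
      then have "((T - a) * c - 1) * y \<le> ((T - a) * c - 1) * Q T"
        using \<open>y \<le> Q T\<close> by (intro mult_left_mono) auto
      then show ?thesis using * by (simp add: \<epsilon>_def)
    qed
  qed
  have "(\<lambda>L. (T - a) * (4 * real n ^ 2 * \<kappa>) / real L) \<longlonglongrightarrow> 0" by (rule lim_const_over_n)
  then have "((T - a) * c - 1) * y \<le> 0"
    by (rule tendsto_lowerbound)
       (use bound in \<open>auto intro!: eventually_sequentiallyI[of "4 * n"]\<close>)
  then have "(T - a) * c \<le> 1" using y by (simp add: mult_le_0_iff)
  then show ?thesis using c by (simp add: a_def T_def field_simps)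
qed

section \<open>Summation over dyadic blocks\<close>

theorem tinf_finite:
  assumes a0: "0 < a0" and \<alpha>: "0 < \<alpha>"
    and lb: "\<And>i j. 1 \<le> i \<Longrightarrow> 1 \<le> j \<Longrightarrow>
               a0 * (min (ln (real i + 1)) (ln (real j + 1))) powr (1 + \<alpha>) \<le> K i j"
  shows "tinf t < \<infinity>"
proof -
  define c where "c r = a0 * ln (real (2 ^ r) + 1) powr (1 + \<alpha>)" for r :: nat
  have c: "0 < c r" for r
  proof -
    have "0 < ln (real (2 ^ r) + 1)" by (intro ln_gt_zero) simp
    then show ?thesis using a0 unfolding c_def by (simp del: of_nat_power)
  qed
  \<comment> \<open>Comes from \<open>ln (2 ^ r + 1) \<ge> ln 2 / 2 * (r + 1)\<close>; using
    \<open>r + 1\<close> instead of \<open>r\<close> keeps the bound nontrivial at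
    \<open>r = 0\<close>.\<close>
  define A where "A = a0 * (ln 2 / 2) powr (1 + \<alpha>)"
  have A: "0 < A" using a0 by (simp add: A_def)
  \<comment> \<open>\<open>t (2 ^ r - 1)\<close> is the time at which the minimal size becomes
    \<open>2 ^ r\<close>, so the differences telescope from \<open>t 0 = 0\<close>.\<close>
  have block: "t (2 ^ Suc r - 1) - t (2 ^ r - 1) \<le> 1 / c r" for r
  proof -
    have "t (2 * 2 ^ r - 1) - t (2 ^ r - 1) \<le> 1 / c r"
    proof (rule block_duration)
      fix i j :: nat assume ij: "2 ^ r \<le> i" "2 ^ r \<le> j"
      have one: "(1::nat) \<le> 2 ^ r" by simp
      have i1: "1 \<le> i" "1 \<le> j" using ij one by linarith+
      have "c r \<le> a0 * (min (ln (real i + 1)) (ln (real j + 1))) powr (1 + \<alpha>)"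
        unfolding c_def using a0 \<alpha> ij by (intro mult_left_mono powr_mono2) (auto simp del: of_nat_power)
      also have "\<dots> \<le> K i j" by (rule lb[OF i1])
      finally show "c r \<le> K i j" .
    qed (use c in auto)
    then show ?thesis by simp
  qed
  have c_lower: "1 / c r \<le> 1 / A * real (Suc r) powr (- (1 + \<alpha>))" for r
  proof -
    have "ln 2 / 2 * real (Suc r) \<le> ln (real (2 ^ r) + 1)"
    proof (cases r)
      case 0
      then show ?thesis by simp
    next
      case (Suc q)
      have "ln 2 * (real (Suc r) / 2) \<le> ln 2 * real r" using Suc by (intro mult_left_mono) auto
      also have "\<dots> = ln (real (2 ^ r))" by (simp add: ln_realpow mult.commute)
      also have "\<dots> \<le> ln (real (2 ^ r) + 1)" by (intro ln_mono) auto
      finally show ?thesis by simp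
    qed
    then have "(ln 2 / 2 * real (Suc r)) powr (1 + \<alpha>) \<le> ln (real (2 ^ r) + 1) powr (1 + \<alpha>)"
      using \<alpha> by (intro powr_mono2) auto
    moreover have "(ln 2 / 2 * real (Suc r)) powr (1 + \<alpha>)
        = (ln 2 / 2) powr (1 + \<alpha>) * real (Suc r) powr (1 + \<alpha>)"
      by (rule powr_mult)
    ultimately have "A * real (Suc r) powr (1 + \<alpha>) \<le> c r"
      using a0 unfolding A_def c_def mult.assoc by (intro mult_left_mono) auto
    then have "1 / c r \<le> 1 / (A * real (Suc r) powr (1 + \<alpha>))"
      using A by (intro divide_left_mono mult_pos_pos c) auto
    also have "\<dots> = 1 / A * real (Suc r) powr (- (1 + \<alpha>))"
      unfolding powr_minus by (simp add: divide_inverse del: of_nat_Suc)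
    finally show ?thesis .
  qed
  have "summable (\<lambda>r. real r powr (- (1 + \<alpha>)))" using \<alpha> by (simp add: summable_real_powr_iff)
  then have "summable (\<lambda>r. real (Suc r) powr (- (1 + \<alpha>)))" by (subst summable_Suc_iff)
  then have "summable (\<lambda>r. 1 / A * real (Suc r) powr (- (1 + \<alpha>)))" by (rule summable_mult)
  then have summ: "summable (\<lambda>r. 1 / c r)"
    by (rule summable_comparison_test'[where N = 0]) (use c c_lower in \<open>auto simp: less_imp_le\<close>)
  define B where "B = (\<Sum>r. 1 / c r)"
  have dyadic: "t (2 ^ m - 1) \<le> B" for m
  proof -
    have "t (2 ^ m - 1) = (\<Sum>r<m. t (2 ^ Suc r - 1) - t (2 ^ r - 1))"
      by (subst sum_lessThan_telescope[of "\<lambda>r. t (2 ^ r - 1)"]) (simp add: t_0)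
    also have "\<dots> \<le> (\<Sum>r<m. 1 / c r)" by (intro sum_mono block)
    also have "\<dots> \<le> B" unfolding B_def using summ c by (intro sum_le_suminf) (auto simp: less_imp_le)
    finally show ?thesis .
  qed
  \<comment> \<open>The dyadic times are cofinal among all \<open>t m\<close>, because
    \<open>m \<le> 2 ^ m - 1\<close>.\<close>
  have "t m \<le> B" for m
  proof -
    have "m < 2 ^ m" by (rule less_exp)
    then have "m \<le> 2 ^ m - 1" by linarith
    then have "t m \<le> t (2 ^ m - 1)" using t_strict by (simp add: strict_mono_less_eq)
    then show ?thesis using dyadic[of m] by linarith
  qed
  then have "tinf t \<le> ereal B" unfolding tinf_def by (intro SUP_least) simp
  then show ?thesis by (rule le_less_trans) simp
qed

end

theorem theorem1p3:
  fixes K :: "nat \<Rightarrow> nat \<Rightarrow> real" and \<kappa> :: real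
    and x0 :: "nat \<Rightarrow> real" and l :: "real \<Rightarrow> nat" and x :: "real \<Rightarrow> nat \<Rightarrow> real"
    and t :: "nat \<Rightarrow> real"
  assumes kappa_pos: "\<kappa> > 0"
    and K_nonneg: "\<And>i j. 1 \<le> i \<Longrightarrow> 1 \<le> j \<Longrightarrow> 0 \<le> K i j"
    and K_sym: "\<And>i j. 1 \<le> i \<Longrightarrow> 1 \<le> j \<Longrightarrow> K i j = K j i"
    and K_bound: "\<And>i j. 1 \<le> i \<Longrightarrow> 1 \<le> j \<Longrightarrow> K i j \<le> \<kappa> * real i * real j"
    and delta_pos: "\<And>i. 1 \<le> i \<Longrightarrow> (INF j\<in>{i..}. K i j) > 0"
    and x0_X11: "in_X11 x0"
    and x0_nonneg: "\<And>i. 1 \<le> i \<Longrightarrow> 0 \<le> x0 i"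
    and x0_1: "x0 1 > 0"
    and x0_norm: "norm11 x0 = 1"
    and sol: "is_mdc_solution K x0 l x t"
  shows "((\<exists>A0>0. \<forall>i\<ge>1. \<forall>j\<ge>1. K i j \<le> min (ln (real i + 1)) (ln (real j + 1)) / (4 * A0))
            \<longrightarrow> tinf t = \<infinity>)
       \<and> ((\<exists>a0>0. \<exists>\<alpha>>0. \<forall>i\<ge>1. \<forall>j\<ge>1.
              K i j \<ge> a0 * (min (ln (real i + 1)) (ln (real j + 1))) powr (1 + \<alpha>))
            \<longrightarrow> tinf t < \<infinity>)"
proof -
  interpret min_driven_coagulation K \<kappa> x0 l x t
    by unfold_locales (fact assms)+
  show ?thesis
  proof (intro conjI impI)
    assume "\<exists>A0>0. \<forall>i\<ge>1. \<forall>j\<ge>1. K i j \<le> min (ln (real i + 1)) (ln (real j + 1)) / (4 * A0)"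
    then obtain A0 where A0: "A0 > 0"
      "\<And>i j. i \<ge> 1 \<Longrightarrow> j \<ge> 1 \<Longrightarrow> K i j \<le> min (ln (real i + 1)) (ln (real j + 1)) / (4 * A0)"
      by blast
    show "tinf t = \<infinity>"
    proof (rule tinf_infinite[of "1 / (4 * A0)"])
      fix i j :: nat assume ij: "1 \<le> i" "i \<le> j"
      then have "K i j \<le> min (ln (real i + 1)) (ln (real j + 1)) / (4 * A0)" by (intro A0) auto
      also have "\<dots> \<le> ln (real i + 1) / (4 * A0)" using A0(1) by (intro divide_right_mono) auto
      finally show "K i j \<le> 1 / (4 * A0) * ln (real i + 1)" by simp
    qed (use A0 in simp)
  next
    assume "\<exists>a0>0. \<exists>\<alpha>>0. \<forall>i\<ge>1. \<forall>j\<ge>1.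
        K i j \<ge> a0 * (min (ln (real i + 1)) (ln (real j + 1))) powr (1 + \<alpha>)"
    then show "tinf t < \<infinity>" using tinf_finite by blast
  qed
qed

end
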